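(* Let $n\ge 1$ be an integer, $B>0$, $p\ge 1$, and let $f:[0,\infty)\to[0,\infty)$ be continuous with $f(0)=0$. Put $g_p(x)=f(x)^p$ for $x\ge 0$ and $r(x)=g_p(x)/x=f(x)^p/x$ for $x>0$. Then for every $\mathbf{x}=(x_1,\ldots,x_n)\in\mathcal{B}_B$, $$\sum_{i=1}^n g_p(x_i)\;\le\; B\,\sup_{0<x\le B} r(x).$$
   Context: For $B>0$, $\mathcal{B}_B=\{\mathbf{x}\in[0,\infty)^n:\sum_{i=1}^n x_i=B\}$ is the scaled simplex of feasible allocations. The supremum is taken in the extended nonnegative reals (it may be $+\infty$, in which case the inequality is trivially true). *)

theory Defs
  imports "HOL-Analysis.Analysis"
begin

definition scaled_simplex :: "real \<Rightarrow> (real ^ 'n) set" where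
  "scaled_simplex B = {x. (\<forall>i. 0 \<le> x $ i) \<and> (\<Sum>i\<in>UNIV. x $ i) = B}"

(* f is applied to nonnegative arguments only and takes nonnegative values there, so
   powr is the usual real power t^p with p > 0, including 0 powr p = 0. *)
definition pow_fun :: "(real \<Rightarrow> real) \<Rightarrow> real \<Rightarrow> real \<Rightarrow> real" where
  "pow_fun f p x = f x powr p"

definition ratio_fun :: "(real \<Rightarrow> real) \<Rightarrow> real \<Rightarrow> real \<Rightarrow> real" where
  "ratio_fun f p x = pow_fun f p x / x"

end

theory Submission
  imports Defs
begin

text \<open>Each coordinate \<open>t\<close> of a point of the simplex lies in
  \<open>[0, B]\<close>, by \<open>scaled_simplex_le\<close>. If \<open>t > 0\<close>, then
  \<open>pow_fun f p t\<close> is \<open>t\<close> times the ratio at \<open>t\<close>, hence at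
  most \<open>t\<close> times the supremum; \<open>pow_fun_le_mult_SUP_ratio_fun\<close> records
  this and covers \<open>t = 0\<close> too. Summing over the coordinates, the weights
  \<open>t\<close> add up to \<open>B\<close>.\<close>

lemma scaled_simplex_le:
  assumes "x \<in> scaled_simplex B"
  shows "x $ i \<le> B"
proof -
  have "x $ i \<le> (\<Sum>j\<in>UNIV. x $ j)"
    using assms by (intro member_le_sum) (auto simp: scaled_simplex_def)
  then show ?thesis
    using assms by (simp add: scaled_simplex_def)
qed

lemma pow_fun_le_mult_SUP_ratio_fun:
  assumes "0 \<le> t" "t \<le> B" "f 0 = 0"
  shows "ennreal (pow_fun f p t) \<le> ennreal t * (SUP s\<in>{0<..B}. ennreal (ratio_fun f p s))"
proof (cases "t = 0")
  \<comment> \<open>The point 0 is outside the range of the supremum, so \<open>f 0 = 0\<close> must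
    make the left side vanish.\<close>
  case True
  then show ?thesis
    using assms by (simp add: pow_fun_def)
next
  case False
  then have "ennreal (pow_fun f p t) = ennreal t * ennreal (ratio_fun f p t)"
    using assms by (simp add: ratio_fun_def pow_fun_def flip: ennreal_mult)
  also have "\<dots> \<le> ennreal t * (SUP s\<in>{0<..B}. ennreal (ratio_fun f p s))"
    using assms False by (intro mult_left_mono SUP_upper) auto
  finally show ?thesis .
qed

theorem theorem5p2:
  fixes f :: "real \<Rightarrow> real" and p B :: real and x :: "real ^ 'n"
  assumes "B > 0" and "p \<ge> 1"
    and "continuous_on {0..} f" and "f \<in> {0..} \<rightarrow> {0..}" and "f 0 = 0"
    and "x \<in> scaled_simplex B"
  shows "ennreal (\<Sum>i\<in>UNIV. pow_fun f p (x $ i))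
    \<le> ennreal B * (SUP t\<in>{0<..B}. ennreal (ratio_fun f p t))"
proof -
  let ?S = "SUP t\<in>{0<..B}. ennreal (ratio_fun f p t)"
  have nonneg: "0 \<le> x $ i" for i
    using assms(6) by (simp add: scaled_simplex_def)
  \<comment> \<open>\<open>ennreal\<close> truncates negative reals to 0, so it commutes with this
    sum because values of \<open>powr\<close> are nonnegative.\<close>
  have "ennreal (\<Sum>i\<in>UNIV. pow_fun f p (x $ i)) = (\<Sum>i\<in>UNIV. ennreal (pow_fun f p (x $ i)))"
    by (simp add: pow_fun_def sum_ennreal)
  also have "\<dots> \<le> (\<Sum>i\<in>UNIV. ennreal (x $ i) * ?S)"
    using assms(5,6) nonneg
    by (intro sum_mono pow_fun_le_mult_SUP_ratio_fun scaled_simplex_le)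
  \<comment> \<open>Distributivity in \<open>ennreal\<close> holds even when \<open>?S\<close> is
    infinite, so no finiteness case is needed.\<close>
  also have "\<dots> = ennreal (\<Sum>i\<in>UNIV. x $ i) * ?S"
    using nonneg by (simp add: sum_ennreal flip: sum_distrib_right)
  also have "(\<Sum>i\<in>UNIV. x $ i) = B"
    using assms(6) by (simp add: scaled_simplex_def)
  finally show ?thesis .
qed

end
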